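(* For every finite set $P$ of points in the plane $\mathbb{R}^2$, the size (number of squares) of the cover generated by the algorithm $\mathsf{SquareCover}$ on input $P$ is at most twice the size of any minimum-sized $1$-ply unit square cover of $P$.
   Context: A unit square is a closed axis-aligned square $[a,a+1]\times[b,b+1]$, $a,b\in\mathbb{R}$. For a set $\mathcal{S}$ of geometric objects in the plane, $\mathsf{ply}(\mathcal{S})=\max_{p\in\mathbb{R}^2}|\{s\in\mathcal{S}: p\in s\}|$. A $1$-ply unit square cover of $P$ is a finite set $\mathcal{S}$ of unit squares whose union contains $P$ and with $\mathsf{ply}(\mathcal{S})\le 1$, i.e. the squares are pairwise disjoint. The algorithm $\mathsf{Separate}(Q)$, for a finite set $Q$ of real numbers, sweeps the line from left to right; whenever it encounters a point $q\in Q$ not yet covered, it adds to its output the unit interval $[q,q+1]$. Its output is the resulting set of pairwise disjoint closed unit intervals covering $Q$. The algorithm $\mathsf{SquareCover}(P)$: apply $\mathsf{Separate}$ to the set of $x$-coordinates of the points of $P$, obtaining intervals $I_1,\dots,I_k$ and thereby vertical strips $V_i=I_i\times\mathbb{R}$. For each $i$, apply $\mathsf{Separate}$ to the set of $y$-coordinates of the points of $P$ lying in $V_i$, obtaining intervals $J_{i,1},\dots,J_{i,k_i}$. Output the set of all unit squares $I_i\times J_{i,j}$ with $1\le i\le k$, $1\le j\le k_i$. *)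

theory Defs
  imports Complex_Main
begin

definition unit_square :: "(real \<times> real) set \<Rightarrow> bool" where
  "unit_square s \<longleftrightarrow> (\<exists>a b. s = {a..a+1} \<times> {b..b+1})"

text \<open>Only meaningful for finite \<open>S\<close>, where the set of counts is finite.\<close>

definition ply :: "(real \<times> real) set set \<Rightarrow> nat" where
  "ply S = Max (range (\<lambda>p. card {s \<in> S. p \<in> s}))"

definition one_ply_cover :: "(real \<times> real) set \<Rightarrow> (real \<times> real) set set \<Rightarrow> bool" where
  "one_ply_cover P S \<longleftrightarrow> finite S \<and> (\<forall>s\<in>S. unit_square s) \<and> P \<subseteq> \<Union>S \<and> ply S \<le> 1"

definition minimum_one_ply_cover :: "(real \<times> real) set \<Rightarrow> (real \<times> real) set set \<Rightarrow> bool" where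
  "minimum_one_ply_cover P S \<longleftrightarrow>
     one_ply_cover P S \<and> (\<forall>T. one_ply_cover P T \<longrightarrow> card S \<le> card T)"

text \<open>The first argument of \<open>sweep\<close> holds the intervals output so far, the second the points
  still to be encountered, in increasing order.\<close>

fun sweep :: "real set set \<Rightarrow> real list \<Rightarrow> real set set" where
  "sweep A [] = A"
| "sweep A (q # qs) = (if q \<in> \<Union>A then sweep A qs else sweep (insert {q..q+1} A) qs)"

definition separate :: "real set \<Rightarrow> real set set" where
  "separate Q = sweep {} (sorted_list_of_set Q)"

definition square_cover :: "(real \<times> real) set \<Rightarrow> (real \<times> real) set set" where
  "square_cover P =
     {I \<times> J | I J. I \<in> separate (fst ` P) \<and> J \<in> separate (snd ` (P \<inter> (I \<times> UNIV)))}"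

text \<open>The output of \<open>square_cover\<close> is a 1-ply unit square cover; in particular minimum covers
  exist.\<close>

lemma sweep_props:
  assumes "finite A" "\<forall>I\<in>A. \<exists>a. I = {a..a+1} \<and> (\<forall>q\<in>set qs. a \<le> q)"
    and "pairwise disjnt A" "sorted qs"
  shows "finite (sweep A qs) \<and> (\<forall>I\<in>sweep A qs. \<exists>a. I = {a..a+1}) \<and>
    pairwise disjnt (sweep A qs) \<and> \<Union>A \<union> set qs \<subseteq> \<Union>(sweep A qs)"
  using assms
proof (induction qs arbitrary: A)
  case Nil
  then show ?case by auto
next
  case (Cons q qs)
  show ?case
  proof (cases "q \<in> \<Union>A")
    case True
    have "\<forall>I\<in>A. \<exists>a. I = {a..a+1} \<and> (\<forall>q\<in>set qs. a \<le> q)"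
      using Cons.prems(2) by fastforce
    then show ?thesis using Cons.IH[of A] Cons.prems True by auto
  next
    case False
    let ?B = "insert {q..q+1} A"
    have *: "disjnt {q..q+1} I" if I: "I \<in> A" for I
    proof -
      obtain a where a: "I = {a..a+1}" "a \<le> q" using Cons.prems(2) I by fastforce
      then have "q > a + 1" using False I by force
      then show ?thesis using a by (auto simp: disjnt_def)
    qed
    then have "pairwise disjnt ?B"
      using Cons.prems(3) by (auto simp: pairwise_insert disjnt_sym)
    moreover have "\<forall>I\<in>?B. \<exists>a. I = {a..a+1} \<and> (\<forall>q\<in>set qs. a \<le> q)"
      using Cons.prems(2,4) by fastforce
    ultimately have "finite (sweep ?B qs) \<and> (\<forall>I\<in>sweep ?B qs. \<exists>a. I = {a..a+1}) \<and>
        pairwise disjnt (sweep ?B qs) \<and> \<Union>?B \<union> set qs \<subseteq> \<Union>(sweep ?B qs)"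
      using Cons.prems by (intro Cons.IH) auto
    moreover have "\<Union>(insert {q..q+1} A) \<union> set qs \<supseteq> \<Union>A \<union> set (q # qs)" by auto
    moreover have "sweep A (q # qs) = sweep ?B qs" using False by simp
    ultimately show ?thesis by (metis (no_types, lifting) order_trans)
  qed
qed

lemma separate_props:
  assumes "finite Q"
  shows "finite (separate Q)" "\<forall>I\<in>separate Q. \<exists>a. I = {a..a+1}"
    "pairwise disjnt (separate Q)" "Q \<subseteq> \<Union>(separate Q)"
  using sweep_props[of "{}" "sorted_list_of_set Q"] assms by (auto simp: separate_def)

lemma ply_le_1_iff:
  assumes "finite S"
  shows "ply S \<le> 1 \<longleftrightarrow> pairwise disjnt S"
proof -
  have "range (\<lambda>p. card {s \<in> S. p \<in> s}) \<subseteq> {..card S}"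
    using assms by (auto intro: card_mono)
  then have "finite (range (\<lambda>p. card {s \<in> S. p \<in> s}))"
    using finite_subset by blast
  then have "ply S \<le> 1 \<longleftrightarrow> (\<forall>p. card {s \<in> S. p \<in> s} \<le> 1)"
    by (simp add: ply_def)
  also have "\<dots> \<longleftrightarrow> (\<forall>p. \<forall>s\<in>S. \<forall>t\<in>S. p \<in> s \<longrightarrow> p \<in> t \<longrightarrow> s = t)"
    using assms by (simp add: card_le_Suc0_iff_eq) blast
  also have "\<dots> \<longleftrightarrow> pairwise disjnt S"
    unfolding pairwise_def disjnt_def by blast
  finally show ?thesis .
qed

lemma one_ply_cover_square_cover:
  assumes "finite P"
  shows "one_ply_cover P (square_cover P)"
proof -
  let ?X = "separate (fst ` P)" and ?Y = "\<lambda>I. separate (snd ` (P \<inter> (I \<times> UNIV)))"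
  have X: "finite ?X" "\<forall>I\<in>?X. \<exists>a. I = {a..a+1}" "pairwise disjnt ?X" "fst ` P \<subseteq> \<Union>?X"
    using separate_props[of "fst ` P"] assms by auto
  have Y: "finite (?Y I)" "\<forall>J\<in>?Y I. \<exists>b. J = {b..b+1}" "pairwise disjnt (?Y I)"
    "snd ` (P \<inter> (I \<times> UNIV)) \<subseteq> \<Union>(?Y I)" for I
    using separate_props[of "snd ` (P \<inter> (I \<times> UNIV))"] assms by auto
  have eq: "square_cover P = (\<Union>I\<in>?X. (\<lambda>J. I \<times> J) ` ?Y I)"
    unfolding square_cover_def by blast
  have fin: "finite (square_cover P)" unfolding eq using X(1) Y(1) by blast
  have "pairwise disjnt (square_cover P)"
  proof (rule pairwiseI)
    fix s t assume "s \<in> square_cover P" "t \<in> square_cover P" "s \<noteq> t"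
    then obtain I J I' J' where *: "s = I \<times> J" "t = I' \<times> J'" "I \<in> ?X" "I' \<in> ?X"
      "J \<in> ?Y I" "J' \<in> ?Y I'" "I \<noteq> I' \<or> J \<noteq> J'"
      unfolding square_cover_def by blast
    show "disjnt s t"
    proof (cases "I = I'")
      case True
      then have "disjnt J J'" using * Y(3)[of I] by (auto simp: pairwise_def)
      then show ?thesis using * by (auto simp: disjnt_def)
    next
      case False
      then have "disjnt I I'" using * X(3) by (auto simp: pairwise_def)
      then show ?thesis using * by (auto simp: disjnt_def)
    qed
  qed
  moreover have "unit_square s" if s: "s \<in> square_cover P" for s
  proof -
    obtain I J where "s = I \<times> J" "I \<in> ?X" "J \<in> ?Y I"
      using s unfolding square_cover_def by blast
    then show ?thesis using X(2) Y(2)[of I] unfolding unit_square_def by metis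
  qed
  moreover have "P \<subseteq> \<Union>(square_cover P)"
  proof
    fix p assume p: "p \<in> P"
    then obtain I where I: "I \<in> ?X" "fst p \<in> I" using X(4) by blast
    then have "snd p \<in> snd ` (P \<inter> (I \<times> UNIV))" using p by (intro imageI) (auto simp: mem_Times_iff)
    then obtain J where "J \<in> ?Y I" "snd p \<in> J" using Y(4)[of I] by blast
    then have "I \<times> J \<in> square_cover P" "p \<in> I \<times> J"
      unfolding eq using I by (auto simp: mem_Times_iff)
    then show "p \<in> \<Union>(square_cover P)" by blast
  qed
  ultimately show ?thesis
    unfolding one_ply_cover_def using fin ply_le_1_iff[OF fin] by blast
qed

lemma ex_minimum_one_ply_cover:
  assumes "finite P"
  shows "\<exists>S. minimum_one_ply_cover P S"
  using ex_has_least_nat[of "one_ply_cover P" _ card] one_ply_cover_square_cover[OF assms]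
  unfolding minimum_one_ply_cover_def by blast

end

(* The bottom edge of every output square t carries a point of P. A square s of any cover that
   contains this point meets t, and its top edge lies in the y-range of t; since a unit
   interval contains an endpoint of every unit interval that it meets, t contains one of the
   two top corners of s. The output squares are pairwise disjoint, so there are at most as many of them as top
   corners, two for each square of the cover. *)
theory Submission imports Defs begin

lemma sweep_left_endpoint:
  assumes "I \<in> sweep A qs"
  shows "I \<in> A \<or> (\<exists>q\<in>set qs. I = {q..q+1})"
  using assms by (induction A qs rule: sweep.induct) (auto split: if_splits)

lemma separate_left_endpoint:
  assumes "finite Q" "I \<in> separate Q"
  shows "\<exists>q\<in>Q. I = {q..q+1}"
  using assms sweep_left_endpoint[of I "{}" "sorted_list_of_set Q"]
  by (simp add: separate_def)

text \<open>The sweep of a strip opens an interval only at the \<open>y\<close>-coordinate of a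
  point of \<open>P\<close> in that strip. This point need not be the one that opened the strip, so
  its abscissa is only located within \<open>{a..a+1}\<close>.\<close>

lemma square_cover_bottom_point:
  assumes "finite P" "t \<in> square_cover P"
  obtains a x y where "t = {a..a+1} \<times> {y..y+1}" "(x, y) \<in> P" "x \<in> {a..a+1}"
proof -
  obtain I J where t: "t = I \<times> J" "I \<in> separate (fst ` P)"
      "J \<in> separate (snd ` (P \<inter> (I \<times> UNIV)))"
    using assms(2) unfolding square_cover_def by blast
  obtain a where a: "I = {a..a+1}"
    using separate_left_endpoint[OF _ t(2)] assms(1) by blast
  obtain y where "y \<in> snd ` (P \<inter> (I \<times> UNIV))" "J = {y..y+1}"
    using separate_left_endpoint[OF _ t(3)] assms(1) by blast
  then show ?thesis using that t(1) a by auto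
qed

text \<open>Choosing a point of \<open>C\<close> in each member of \<open>F\<close> is injective,
  since disjoint members cannot share the chosen point.\<close>

lemma card_le_if_disjnt_hit:
  assumes "pairwise disjnt F" "finite C" "\<And>t. t \<in> F \<Longrightarrow> t \<inter> C \<noteq> {}"
  shows "card F \<le> card C"
proof -
  have "\<forall>t\<in>F. \<exists>p. p \<in> t \<inter> C"
    using assms(3) by blast
  then obtain g where g: "\<And>t. t \<in> F \<Longrightarrow> g t \<in> t \<inter> C"
    using bchoice by metis
  then have "inj_on g F"
    using assms(1) unfolding inj_on_def pairwise_def disjnt_def by (metis IntD1 IntI empty_iff)
  then show ?thesis
    using card_inj_on_le[of g F C] g assms(2) by blast
qed

theorem theorem2:
  fixes P :: "(real \<times> real) set" and S :: "(real \<times> real) set set"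
  assumes "finite P"
    and "minimum_one_ply_cover P S"
  shows "card (square_cover P) \<le> 2 * card S"
proof -
  have S: "finite S" "\<forall>s\<in>S. unit_square s" "P \<subseteq> \<Union>S"
    using assms(2) unfolding minimum_one_ply_cover_def one_ply_cover_def by auto
  obtain c d where cd: "\<And>s. s \<in> S \<Longrightarrow> s = {c s..c s+1} \<times> {d s..d s+1}"
    using S(2) unfolding unit_square_def by metis
  let ?L = "(\<lambda>s. (c s, d s + 1)) ` S" and ?R = "(\<lambda>s. (c s + 1, d s + 1)) ` S"
  have "t \<inter> (?L \<union> ?R) \<noteq> {}" if t: "t \<in> square_cover P" for t
  proof -
    obtain a x y where axy: "t = {a..a+1} \<times> {y..y+1}" "(x, y) \<in> P" "x \<in> {a..a+1}"
      using square_cover_bottom_point[OF assms(1) t] .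
    obtain s where s: "s \<in> S" "(x, y) \<in> s" using S(3) axy(2) by blast
    then have "(x, y) \<in> {c s..c s+1} \<times> {d s..d s+1}" using cd by metis
    \<comment> \<open>The height fits because \<open>d s \<le> y \<le> d s + 1\<close>. The left
      corner works if \<open>a \<le> c s\<close>; otherwise
      \<open>c s < a \<le> x \<le> c s + 1\<close> and the right one does.\<close>
    then have "(c s, d s + 1) \<in> t \<or> (c s + 1, d s + 1) \<in> t" using axy(1,3) by auto
    then show ?thesis using s(1) by blast
  qed
  moreover have "pairwise disjnt (square_cover P)"
    using one_ply_cover_square_cover[OF assms(1)] ply_le_1_iff
    unfolding one_ply_cover_def by blast
  ultimately have "card (square_cover P) \<le> card (?L \<union> ?R)"
    using S(1) by (intro card_le_if_disjnt_hit) auto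
  also have "\<dots> \<le> card ?L + card ?R" by (rule card_Un_le)
  also have "\<dots> \<le> card S + card S" using S(1) by (intro add_mono card_image_le)
  finally show ?thesis by simp
qed

end
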